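(* Let $1\le k_1<k_2<\cdots<k_s$ be integers, $r=\lfloor\log_2(k_s)\rfloor+1$, and $$c_0(k_1,\dots,k_s)=\frac{1}{2^r}\sum_{m=0}^{2^r-1}(-1)^{\binom{m}{k_1}+\cdots+\binom{m}{k_s}}.$$ Then $$c_0(k_1,\dots,k_s)=1-\sum_{i=1}^s2^{1-w_2(k_i)}+\sum_{i_1<i_2}2^{2-w_2(k_{i_1}\vee k_{i_2})}-\sum_{i_1<i_2<i_3}2^{3-w_2(k_{i_1}\vee k_{i_2}\vee k_{i_3})}+\cdots+(-1)^s2^{s-w_2(k_1\vee k_2\vee\cdots\vee k_s)},$$ i.e. $c_0(k_1,\dots,k_s)=1+\sum_{j=1}^s(-1)^j\sum_{1\le i_1<\cdots<i_j\le s}2^{\,j-w_2(k_{i_1}\vee\cdots\vee k_{i_j})}$.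
   Context: $w_2(k)$ is the sum of the binary digits of $k$. For natural numbers $m,n$, $m\vee n$ is the bitwise OR of their binary digits (e.g. $3\vee8=11$). The quantity $c_0(k_1,\dots,k_s)$ equals $\lim_{n\to\infty}2^{-n}\sum_{j=0}^n(-1)^{\binom{j}{k_1}+\cdots+\binom{j}{k_s}}\binom{n}{j}$, the limiting correlation of the symmetric Boolean function $\sigma_{n,k_1}+\cdots+\sigma_{n,k_s}$. *)

theory Defs
  imports Complex_Main
begin

unbundle bit_operations_syntax

text \<open>The binary digit of \<open>k\<close> at position \<open>i\<close> is \<open>k div 2 ^ i mod 2\<close>; the range \<open>i < k\<close>
  loses no digit because \<open>k < 2 ^ k\<close>.\<close>

definition w2 :: "nat \<Rightarrow> nat" where
  "w2 k = (\<Sum>i<k. k div 2 ^ i mod 2)"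

definition big_or :: "('i \<Rightarrow> nat) \<Rightarrow> 'i set \<Rightarrow> nat" where
  "big_or k I = Finite_Set.fold (\<lambda>i. (OR) (k i)) 0 I"

text \<open>The sequence \<open>k\<^sub>1, \<dots>, k\<^sub>s\<close> is a function on \<open>nat\<close>, of which only the values on
  \<open>{1..s}\<close> are used. For \<open>1 \<le> k\<^sub>s\<close> the logarithm is nonnegative, so \<open>nat\<close> does not truncate.\<close>

definition c0 :: "nat \<Rightarrow> (nat \<Rightarrow> nat) \<Rightarrow> real" where
  "c0 s k =
    (let r = nat \<lfloor>log 2 (real (k s))\<rfloor> + 1
     in 1 / 2 ^ r * (\<Sum>m = 0..2 ^ r - 1. (- 1) ^ (\<Sum>i = 1..s. m choose k i)))"

lemma w2_eq_card: "w2 k = card {i. bit k i}"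
proof -
  have "i < k" if "bit k i" for i
  proof (rule ccontr)
    assume "\<not> i < k"
    then have "k < 2 ^ i"
      using less_exp[of i] by linarith
    with that show False
      by (simp add: bit_iff_odd)
  qed
  then have "{i. bit k i} = {i \<in> {..<k}. bit k i}"
    by auto
  moreover have "w2 k = (\<Sum>i<k. if bit k i then 1 else 0)"
    unfolding w2_def by (intro sum.cong) (auto simp: bit_iff_odd odd_iff_mod_2_eq_one)
  ultimately show ?thesis
    by (simp add: sum.If_cases Int_def)
qed

lemma big_or_empty [simp]: "big_or k {} = 0"
  by (simp add: big_or_def)

lemma big_or_insert [simp]:
  assumes "finite I" and "i \<notin> I"
  shows "big_or k (insert i I) = k i OR big_or k I"
proof -
  interpret comp_fun_commute "\<lambda>i. (OR) (k i)"
    by standard (simp add: fun_eq_iff or.left_commute)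
  show ?thesis
    using assms by (simp add: big_or_def)
qed

end

theory Submission
  imports Defs
begin

text \<open>By Lucas modulo 2, \<open>m choose k\<close> is odd exactly when every binary digit of \<open>k\<close> is dominated by
  that of \<open>m\<close>. Hence the sign is the product over \<open>i\<close> of \<open>1 - 2 * [m dominates k i]\<close>; expanding it
  gives a sum over subsets \<open>I\<close> of \<open>(-2) ^ card I * [m dominates big_or k I]\<close>, and among the
  \<open>m < 2 ^ r\<close> exactly \<open>2 ^ (r - w2 K)\<close> dominate a given \<open>K < 2 ^ r\<close>.\<close>

definition submask :: "nat \<Rightarrow> nat \<Rightarrow> bool" where
  "submask k m \<longleftrightarrow> (\<forall>b. bit k b \<longrightarrow> bit m b)"

lemma submask_0_left [simp]: "submask 0 m"
  by (simp add: submask_def)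

lemma submask_0_right [simp]: "submask k 0 \<longleftrightarrow> k = 0"
  by (auto simp: submask_def bit_eq_iff)

lemma submask_or_iff: "submask (k OR l) m \<longleftrightarrow> submask k m \<and> submask l m"
  by (auto simp: submask_def bit_simps)

lemma submask_rec: "submask k m \<longleftrightarrow> (odd k \<longrightarrow> odd m) \<and> submask (k div 2) (m div 2)"
proof -
  have "(\<forall>b. P b) \<longleftrightarrow> P 0 \<and> (\<forall>b. P (Suc b))" for P :: "nat \<Rightarrow> bool"
    by (metis not0_implies_Suc)
  from this[of "\<lambda>b. bit k b \<longrightarrow> bit m b"] show ?thesis
    by (simp add: submask_def bit_0 bit_Suc)
qed

lemma submask_big_or_iff:
  "finite I \<Longrightarrow> submask (big_or k I) m \<longleftrightarrow> (\<forall>i\<in>I. submask (k i) m)"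
  by (induction rule: finite_induct) (simp_all add: submask_or_iff)

text \<open>Modulo 2, (1 + x)^(2n) = (1 + x^2)^n. In the induction, Pascal's rule is applied twice,
  from row 2n to row 2n + 2: the middle entry occurs twice and drops out, which leaves Pascal's rule
  for row n.\<close>

lemma even_choose_double:
  "(even (2 * n choose (2 * k)) \<longleftrightarrow> even (n choose k)) \<and> even (2 * n choose Suc (2 * k))"
proof (induction n arbitrary: k)
  case 0
  then show ?case by (cases k) simp_all
next
  case (Suc n)
  show ?case
  proof (cases k)
    case 0
    then show ?thesis by simp
  next
    case [simp]: (Suc l)
    show ?thesis
      using Suc.IH[of l] Suc.IH[of "Suc l"] by simp
  qed
qed

text \<open>By Pascal's rule an entry of row 2n + 1 is a sum of two neighbours in row 2n, and the
  one with odd lower index is even. For \<open>k = 0\<close> there is only one neighbour, hence the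
  case split.\<close>

lemma even_choose_Suc_double:
  "even (Suc (2 * n) choose (2 * k)) \<longleftrightarrow> even (n choose k)"
  "even (Suc (2 * n) choose Suc (2 * k)) \<longleftrightarrow> even (n choose k)"
proof -
  show "even (Suc (2 * n) choose Suc (2 * k)) \<longleftrightarrow> even (n choose k)"
    by (simp add: even_choose_double)
  show "even (Suc (2 * n) choose (2 * k)) \<longleftrightarrow> even (n choose k)"
    using even_choose_double[of n k] even_choose_double[of n "k - 1"] by (cases k) simp_all
qed

text \<open>Strong induction that removes the lowest digit of both numbers. By the parity lemmas,
  this preserves the parity of the coefficient unless \<open>k\<close> is odd and \<open>n\<close>
  even, when the coefficient is even.\<close>

lemma odd_choose_iff: "odd (n choose k) \<longleftrightarrow> submask k n"
proof (induction n arbitrary: k rule: less_induct)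
  case (less n)
  show ?case
  proof (cases "n = 0")
    case True
    then show ?thesis by (cases k) simp_all
  next
    case False
    then have IH: "odd (n div 2 choose (k div 2)) \<longleftrightarrow> submask (k div 2) (n div 2)"
      by (intro less) simp
    define m l where "m = n div 2" and "l = k div 2"
    have "n = 2 * m \<or> n = Suc (2 * m)" "k = 2 * l \<or> k = Suc (2 * l)"
      unfolding m_def l_def by presburger+
    moreover have "even n \<longleftrightarrow> n = 2 * m" "even k \<longleftrightarrow> k = 2 * l"
      unfolding m_def l_def by presburger+
    ultimately have "odd (n choose k) \<longleftrightarrow> (odd k \<longrightarrow> odd n) \<and> odd (m choose l)"
      using even_choose_double[of m l] even_choose_Suc_double[of m l] by metis
    with IH show ?thesis
      by (simp add: m_def l_def submask_rec[of k n])
  qed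
qed

lemma w2_rec: "w2 k = k mod 2 + w2 (k div 2)"
proof -
  have fin: "finite {b. bit n b}" for n :: nat
  proof (rule finite_subset)
    show "{b. bit n b} \<subseteq> {..<n}"
      by (auto simp: bit_iff_odd) (metis div_less even_zero less_exp less_trans not_less_iff_gr_or_eq)
  qed simp
  have "{b. bit k b} = (if odd k then {0} else {}) \<union> Suc ` {b. bit (k div 2) b}"
  proof (intro set_eqI)
    fix b
    show "b \<in> {b. bit k b} \<longleftrightarrow> b \<in> (if odd k then {0} else {}) \<union> Suc ` {b. bit (k div 2) b}"
      by (cases b) (auto simp: bit_0 bit_Suc)
  qed
  then show ?thesis
    using fin[of "k div 2"]
    by (auto simp: w2_eq_card card_image card_insert_if odd_iff_mod_2_eq_one)
qed

text \<open>A digit of \<open>m\<close> is forced where \<open>k\<close> has a 1 and free at the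
  other \<open>r - w2 k\<close> positions. The product form avoids truncated subtraction in the
  exponent.\<close>

lemma card_dominating:
  "k < 2 ^ r \<Longrightarrow> card {m. m < 2 ^ r \<and> submask k m} * 2 ^ w2 k = 2 ^ r"
proof (induction r arbitrary: k)
  case 0
  then have "k = 0" "{m. m < 2 ^ 0 \<and> submask k m} = {0}"
    by auto
  then show ?case
    by (simp add: w2_def)
next
  case (Suc r)
  define l where "l = k div 2"
  define D where "D = {m. m < 2 ^ r \<and> submask l m}"
  have IH: "card D * 2 ^ w2 l = 2 ^ r"
    unfolding D_def using Suc.prems by (intro Suc.IH) (auto simp: l_def)
  have fin: "finite D"
    by (simp add: D_def)
  \<comment> \<open>The lowest digit of \<open>m\<close> must be 1 if \<open>k\<close> is odd and is
    free otherwise. So an odd \<open>k\<close> keeps the count \<open>card D\<close> and raises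
    \<open>w2\<close> by one, while an even \<open>k\<close> doubles the count and keeps
    \<open>w2\<close>.\<close>
  have split: "{m. m < 2 ^ Suc r \<and> submask k m} =
      (if odd k then {} else (\<lambda>m. 2 * m) ` D) \<union> (\<lambda>m. Suc (2 * m)) ` D"
  proof (intro set_eqI)
    fix m :: nat
    define n where "n = m div 2"
    have "m = 2 * n \<or> m = Suc (2 * n)"
      unfolding n_def by presburger
    then show "m \<in> {m. m < 2 ^ Suc r \<and> submask k m} \<longleftrightarrow>
      m \<in> (if odd k then {} else (\<lambda>m. 2 * m) ` D) \<union> (\<lambda>m. Suc (2 * m)) ` D"
      unfolding D_def l_def
      by (auto simp: submask_rec[of k "2 * _"] submask_rec[of k "Suc (2 * _)"] image_iff)
  qed
  have card: "card ((\<lambda>m. 2 * m) ` D) = card D" "card ((\<lambda>m. Suc (2 * m)) ` D) = card D"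
    by (auto intro!: card_image inj_onI)
  show ?case
  proof (cases "odd k")
    case True
    then show ?thesis
      using IH unfolding split by (simp add: card w2_rec[of k] l_def[symmetric] odd_iff_mod_2_eq_one)
  next
    case False
    moreover have "((\<lambda>m. 2 * m) ` D) \<inter> ((\<lambda>m. Suc (2 * m)) ` D) = {}"
      by auto presburger
    ultimately show ?thesis
      using IH fin unfolding split
      by (simp add: card card_Un_disjoint w2_rec[of k] l_def[symmetric] even_iff_mod_2_eq_zero
          flip: mult_2)
  qed
qed

lemma big_or_less:
  "finite I \<Longrightarrow> (\<And>i. i \<in> I \<Longrightarrow> k i < 2 ^ r) \<Longrightarrow> big_or k I < 2 ^ r"
proof (induction rule: finite_induct)
  case (insert i I)
  then show ?case
    by (simp add: or_nat_def nat_less_iff OR_upper)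
qed simp

lemma sign_expansion:
  fixes k :: "'i \<Rightarrow> nat"
  assumes "finite A"
  shows "(- 1 :: real) ^ (\<Sum>i\<in>A. m choose k i) =
    (\<Sum>I\<in>Pow A. (- 2) ^ card I * of_bool (submask (big_or k I) m))"
proof -
  \<comment> \<open>A sign is 1 - 2 * [exponent odd]; as a binomial with second summand 1, the
    product expands into one term for each subset of \<open>A\<close>.\<close>
  have "(- 1 :: real) ^ (\<Sum>i\<in>A. m choose k i) = (\<Prod>i\<in>A. (- 2) * of_bool (submask (k i) m) + 1)"
    unfolding power_sum odd_choose_iff[symmetric]
    by (intro prod.cong) simp_all
  also have "\<dots> = (\<Sum>I\<in>Pow A. \<Prod>i\<in>I. (- 2) * of_bool (submask (k i) m))"
    by (subst prod_add[OF assms]) simp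
  also have "\<dots> = (\<Sum>I\<in>Pow A. (- 2) ^ card I * of_bool (submask (big_or k I) m))"
  proof (rule sum.cong[OF refl])
    fix I assume "I \<in> Pow A"
    with assms have "finite I"
      by (auto intro: finite_subset)
    then show "(\<Prod>i\<in>I. (- 2 :: real) * of_bool (submask (k i) m)) =
        (- 2) ^ card I * of_bool (submask (big_or k I) m)"
      \<comment> \<open>A product of indicators is the indicator of the conjunction, and
        \<open>m\<close> dominates all the \<open>k i\<close> exactly when it dominates their
        OR.\<close>
      by (induction rule: finite_induct) (auto simp: submask_or_iff)
  qed
  finally show ?thesis .
qed

text \<open>The sums over \<open>m\<close> and \<open>I\<close> are exchanged, and each inner sum is
  counted by \<open>card_dominating\<close>. The exponent is an integer because
  \<open>w2 (big_or k I)\<close> may exceed \<open>card I\<close>.\<close>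

lemma mean_sign:
  fixes k :: "'i \<Rightarrow> nat"
  assumes "finite A" and "\<And>i. i \<in> A \<Longrightarrow> k i < 2 ^ r"
  shows "1 / 2 ^ r * (\<Sum>m<2 ^ r. (- 1 :: real) ^ (\<Sum>i\<in>A. m choose k i)) =
    (\<Sum>I\<in>Pow A. (- 1) ^ card I * 2 powi (int (card I) - int (w2 (big_or k I))))"
proof -
  have *: "1 / 2 ^ r * (\<Sum>m<2 ^ r. (- 2 :: real) ^ card I * of_bool (submask (big_or k I) m)) =
      (- 1) ^ card I * 2 powi (int (card I) - int (w2 (big_or k I)))" if "I \<in> Pow A" for I
  proof -
    let ?K = "big_or k I"
    let ?D = "{m. m < 2 ^ r \<and> submask ?K m}"
    from that assms have "?K < 2 ^ r"
      by (intro big_or_less) (auto intro: finite_subset)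
    then have "real (card ?D) * 2 ^ w2 ?K = 2 ^ r"
      using card_dominating[of ?K r] by (metis of_nat_mult of_nat_numeral of_nat_power)
    then have "real (card ?D) / 2 ^ r = 1 / 2 ^ w2 ?K"
      by (simp add: field_simps)
    moreover have "(\<Sum>m<2 ^ r. of_bool (submask ?K m)) = real (card ?D)"
      by (simp add: Int_def)
    ultimately have sum: "(\<Sum>m<2 ^ r. of_bool (submask ?K m)) / 2 ^ r = 1 / (2 :: real) ^ w2 ?K"
      by (simp only:)
    have "1 / 2 ^ r * (\<Sum>m<2 ^ r. (- 2 :: real) ^ card I * of_bool (submask ?K m)) =
        (- 2) ^ card I * ((\<Sum>m<2 ^ r. of_bool (submask ?K m)) / 2 ^ r)"
      by (simp only: sum_distrib_left[symmetric]) (simp only: times_divide_eq_right mult_1 times_divide_eq_left)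
    also have "\<dots> = (- 2) ^ card I * (1 / 2 ^ w2 ?K)"
      by (simp only: sum)
    finally show ?thesis
      by (simp add: power_int_diff power_minus[of 2])
  qed
  have "1 / 2 ^ r * (\<Sum>m<2 ^ r. (- 1 :: real) ^ (\<Sum>i\<in>A. m choose k i)) =
      (\<Sum>I\<in>Pow A. 1 / 2 ^ r * (\<Sum>m<2 ^ r. (- 2) ^ card I * of_bool (submask (big_or k I) m)))"
    unfolding sign_expansion[OF assms(1)] by (subst sum.swap) (rule sum_distrib_left)
  with * show ?thesis
    by simp
qed

theorem mainTheorem9:
  fixes s :: nat and k :: "nat \<Rightarrow> nat"
  assumes "1 \<le> s"
    and "1 \<le> k 1"
    and "strict_mono_on {1..s} k"
  shows "c0 s k =
    1 + (\<Sum>j = 1..s. (- 1) ^ j *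
      (\<Sum>I | I \<subseteq> {1..s} \<and> card I = j. 2 powi (int j - int (w2 (big_or k I)))))"
proof -
  define r where "r = nat \<lfloor>log 2 (real (k s))\<rfloor> + 1"
  let ?g = "\<lambda>I. (2 :: real) powi (int (card I) - int (w2 (big_or k I)))"
  have mono: "k i \<le> k j" if "i \<in> {1..s}" "j \<in> {1..s}" "i \<le> j" for i j
    using strict_mono_on_leD[OF assms(3)] that by blast
  have pos: "1 \<le> k s"
    using mono[of 1 s] assms(1,2) by simp
  \<comment> \<open>As \<lfloor>x\<rfloor> + 1 > x, the number \<open>k s\<close> has at most
    \<open>r\<close> binary digits, and by monotonicity so does every \<open>k i\<close>.\<close>
  then have "log 2 (real (k s)) < real r"
    unfolding r_def by simp linarith
  then have "real (k s) < 2 powr real r"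
    using pos by (simp add: log_less_iff)
  then have "k s < 2 ^ r"
    by (simp add: powr_realpow)
  then have less: "k i < 2 ^ r" if "i \<in> {1..s}" for i
    using mono[of i s] that by force
  \<comment> \<open>The subtraction is exact since \<open>2 ^ r\<close> is positive.\<close>
  have range: "{0..2 ^ r - 1} = {..<2 ^ r :: nat}"
    by (auto simp: less_eq_Suc_le[symmetric] Suc_diff_1 simp flip: less_Suc_eq_le)
  have "c0 s k = 1 / 2 ^ r * (\<Sum>m<2 ^ r. (- 1) ^ (\<Sum>i\<in>{1..s}. m choose k i))"
    by (simp add: c0_def r_def[symmetric] Let_def range del: One_nat_def)
  also have "\<dots> = (\<Sum>I\<in>Pow {1..s}. (- 1) ^ card I * ?g I)"
    by (rule mean_sign) (use less in auto)
  \<comment> \<open>The subsets are grouped by size, which is at most \<open>s\<close>.\<close>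
  also have "\<dots> = (\<Sum>j = 0..s. \<Sum>I | I \<in> Pow {1..s} \<and> card I = j. (- 1) ^ card I * ?g I)"
    by (rule sum.group[symmetric]) (auto dest: card_mono[rotated])
  also have "\<dots> = (\<Sum>j = 0..s. (- 1) ^ j *
      (\<Sum>I | I \<subseteq> {1..s} \<and> card I = j. 2 powi (int j - int (w2 (big_or k I)))))"
    by (intro sum.cong) (auto simp: sum_distrib_left intro!: sum.cong)
  also have "\<dots> = 1 + (\<Sum>j = 1..s. (- 1) ^ j *
      (\<Sum>I | I \<subseteq> {1..s} \<and> card I = j. 2 powi (int j - int (w2 (big_or k I)))))"
  proof -
    \<comment> \<open>The leading 1 is the term \<open>j = 0\<close>: only the empty set
      contributes, with OR equal to 0 and hence exponent 0.\<close>
    have "{I. I \<subseteq> {1..s} \<and> card I = 0} = {{}}"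
      by (auto dest: finite_subset)
    then show ?thesis
      by (simp add: sum.atLeast_Suc_atMost w2_def del: card_0_eq card_eq_0_iff)
  qed
  finally show ?thesis .
qed

end
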